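(* Let $1\le p\le2$ (or any $p\ge1$ if $\mathcal{I}$ is finite) and $r>0$, with $r\ge1/4$ if $p=1$. Let $T:\ell_2(\mathcal{I})\to\ell_2(\mathcal{K})$ be a bounded linear operator with $\|T\|<1$ ($\mathcal{I},\mathcal{K}$ countable), $g\in\ell_2(\mathcal{K})$, and $\mathcal{J}^p_r(u)=\|Tu-g\|^2_{\ell_2(\mathcal{K})}+\sum_{i\in\mathcal{I}}\min\{|u_i|^p,r^p\}$. A point $\bar u\in\ell_2(\mathcal{I})$ satisfying the fixed point relation stated in the context is a local minimizer of the functional $\mathcal{J}^p_r$.
   Context: For $p>1$: $F_p(t)=t+\frac p2\operatorname{sgn}(t)|t|^{p-1}$, with inverse $F_p^{-1}:\mathbb{R}\to\mathbb{R}$; $\lambda'(r,p)\in(r,r+\frac p2r^{p-1})$ is the unique positive value $\lambda'$ with $(F_p^{-1}(\lambda')-\lambda')^2+|F_p^{-1}(\lambda')|^p=r^p$; and $\delta(r,p)=\lambda'(r,p)-F_p^{-1}(\lambda'(r,p))>0$. For $p=1$, $r\ge1/4$: $\lambda'(r,1)=r+1/4$. Fixed point relation for $\bar u$: 1. $|\bar u_i|\ge\lambda'(r,p)$ if $i\in\mathcal{I}_1=\{j\in\mathcal{I}:|\bar u_j|>r\}$. 2. For $p>1$: $|\bar u_i|\le F_p^{-1}(\lambda'(r,p))$ if $i\in\mathcal{I}_0=\{j\in\mathcal{I}:|\bar u_j|\le r\}$. 3. (a) If $p>1$: $[T^*(g-T\bar u)]_i=0$ if $|\bar u_i|\ge\lambda'(r,p)$,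 and $[T^*(g-T\bar u)]_i=F_p(\bar u_i)-\bar u_i$ if $|\bar u_i|\le\lambda'(r,p)-\delta(r,p)$. (b) If $p=1$ and $r\ge1/4$: $[T^*(g-T\bar u)]_i\in[-1/2,1/2]$ if $|\bar u_i|\le1/2$; $[T^*(g-T\bar u)]_i=\frac12\operatorname{sgn}\bar u_i$ if $1/2<|\bar u_i|\le r-1/4$; $[T^*(g-T\bar u)]_i=0$ if $|\bar u_i|>r+1/4$.
   Formalization: For p=1 the relation is corrected: the interval [-1/2,1/2] applies only at ū_i=0, the value ½sgn ū_i for 0<|ū_i|≤r-1/4, the value 0 also at |ū_i|=r+1/4, and |ū_i|≤r must give |ū_i|≤r-1/4; as printed, T=0, g=0, r=10, ū=1/4 is a counterexample. *)

theory Defs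
  imports "HOL-Analysis.Analysis"
begin

section \<open>The real Hilbert space of square-summable families\<close>

typedef 'i ell2 = "{x :: 'i \<Rightarrow> real. (\<lambda>i. (x i)\<^sup>2) summable_on UNIV}"
  morphisms ell2_nth Abs_ell2
  by (rule exI[of _ "\<lambda>_. 0"]) simp

setup_lifting type_definition_ell2

notation ell2_nth (infixl "$$" 90)

lemma ell2_eqI: "(\<And>i. x $$ i = y $$ i) \<Longrightarrow> x = y"
  by (simp add: ell2_nth_inject[symmetric] fun_eq_iff)

lemma ell2_summable_sq: "(\<lambda>i. (x $$ i)\<^sup>2) summable_on UNIV"
  using ell2_nth[of x] by simp

lemma ell2_summable_mult: "(\<lambda>i. x $$ i * y $$ i) summable_on UNIV"
proof -
  have "(\<lambda>i. (x $$ i)\<^sup>2 + (y $$ i)\<^sup>2) summable_on UNIV"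
    by (intro summable_on_add ell2_summable_sq)
  hence "(\<lambda>i. norm (x $$ i * y $$ i)) summable_on UNIV"
  proof (rule summable_on_comparison_test)
    fix i :: 'a
    have "0 \<le> (\<bar>x $$ i\<bar> - \<bar>y $$ i\<bar>)\<^sup>2" by simp
    hence "2 * (\<bar>x $$ i\<bar> * \<bar>y $$ i\<bar>) \<le> (x $$ i)\<^sup>2 + (y $$ i)\<^sup>2"
      by (simp add: power2_diff)
    moreover have "0 \<le> \<bar>x $$ i\<bar> * \<bar>y $$ i\<bar>" by simp
    ultimately have "\<bar>x $$ i\<bar> * \<bar>y $$ i\<bar> \<le> (x $$ i)\<^sup>2 + (y $$ i)\<^sup>2" by linarith
    thus "norm (x $$ i * y $$ i) \<le> (x $$ i)\<^sup>2 + (y $$ i)\<^sup>2" by (simp add: abs_mult)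
  qed simp
  thus ?thesis by (rule abs_summable_summable)
qed

instantiation ell2 :: (type) real_vector
begin

lift_definition zero_ell2 :: "'a ell2" is "\<lambda>_. 0" by simp

lift_definition uminus_ell2 :: "'a ell2 \<Rightarrow> 'a ell2" is "\<lambda>x i. - x i" by simp

lift_definition plus_ell2 :: "'a ell2 \<Rightarrow> 'a ell2 \<Rightarrow> 'a ell2" is "\<lambda>x y i. x i + y i"
proof -
  fix x y :: "'a \<Rightarrow> real"
  assume x: "(\<lambda>i. (x i)\<^sup>2) summable_on UNIV" and y: "(\<lambda>i. (y i)\<^sup>2) summable_on UNIV"
  have "(\<lambda>i. 2 * (x i)\<^sup>2 + 2 * (y i)\<^sup>2) summable_on UNIV"
    by (intro summable_on_add summable_on_cmult_right x y)
  thus "(\<lambda>i. (x i + y i)\<^sup>2) summable_on UNIV"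
  proof (rule summable_on_comparison_test)
    fix i
    have "0 \<le> (x i - y i)\<^sup>2" by simp
    thus "(x i + y i)\<^sup>2 \<le> 2 * (x i)\<^sup>2 + 2 * (y i)\<^sup>2" by (simp add: power2_diff power2_sum)
  qed simp
qed

definition minus_ell2 :: "'a ell2 \<Rightarrow> 'a ell2 \<Rightarrow> 'a ell2"
  where "minus_ell2 x y = x + - y"

lift_definition scaleR_ell2 :: "real \<Rightarrow> 'a ell2 \<Rightarrow> 'a ell2" is "\<lambda>c x i. c * x i"
  by (simp add: power_mult_distrib summable_on_cmult_right)

instance
proof
  fix x y z :: "'a ell2" and c d :: real
  show "x + y + z = x + (y + z)"
    by (rule ell2_eqI) (simp add: plus_ell2.rep_eq)
  show "x + y = y + x"
    by (rule ell2_eqI) (simp add: plus_ell2.rep_eq)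
  show "0 + x = x"
    by (rule ell2_eqI) (simp add: plus_ell2.rep_eq zero_ell2.rep_eq)
  show "- x + x = 0"
    by (rule ell2_eqI) (simp add: plus_ell2.rep_eq zero_ell2.rep_eq uminus_ell2.rep_eq)
  show "x - y = x + - y"
    by (rule minus_ell2_def)
  show "c *\<^sub>R (x + y) = c *\<^sub>R x + c *\<^sub>R y"
    by (rule ell2_eqI) (simp add: plus_ell2.rep_eq scaleR_ell2.rep_eq algebra_simps)
  show "(c + d) *\<^sub>R x = c *\<^sub>R x + d *\<^sub>R x"
    by (rule ell2_eqI) (simp add: plus_ell2.rep_eq scaleR_ell2.rep_eq algebra_simps)
  show "c *\<^sub>R d *\<^sub>R x = (c * d) *\<^sub>R x"
    by (rule ell2_eqI) (simp add: scaleR_ell2.rep_eq)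
  show "1 *\<^sub>R x = x"
    by (rule ell2_eqI) (simp add: scaleR_ell2.rep_eq)
qed

end

lemma ell2_nth_zero [simp]: "0 $$ i = 0"
  by (simp only: zero_ell2.rep_eq)

lemma ell2_nth_uminus [simp]: "(- x) $$ i = - (x $$ i)"
  by (simp only: uminus_ell2.rep_eq)

lemma ell2_nth_add [simp]: "(x + y) $$ i = x $$ i + y $$ i"
  by (simp only: plus_ell2.rep_eq)

lemma ell2_nth_diff [simp]: "(x - y) $$ i = x $$ i - y $$ i"
  by (simp only: minus_ell2_def ell2_nth_add ell2_nth_uminus diff_conv_add_uminus)

lemma ell2_nth_scaleR [simp]: "(c *\<^sub>R x) $$ i = c * (x $$ i)"
  by (simp only: scaleR_ell2.rep_eq)

instantiation ell2 :: (type) real_inner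
begin

definition inner_ell2 :: "'a ell2 \<Rightarrow> 'a ell2 \<Rightarrow> real"
  where "inner_ell2 x y = (\<Sum>\<^sub>\<infinity>i. x $$ i * y $$ i)"

definition norm_ell2 :: "'a ell2 \<Rightarrow> real"
  where "norm_ell2 x = sqrt (inner x x)"

definition dist_ell2 :: "'a ell2 \<Rightarrow> 'a ell2 \<Rightarrow> real"
  where "dist_ell2 x y = norm (x - y)"

definition sgn_ell2 :: "'a ell2 \<Rightarrow> 'a ell2"
  where "sgn_ell2 x = x /\<^sub>R norm x"

definition uniformity_ell2 :: "('a ell2 \<times> 'a ell2) filter"
  where "uniformity_ell2 = (INF e\<in>{0 <..}. principal {(x, y). dist x y < e})"

definition open_ell2 :: "'a ell2 set \<Rightarrow> bool"
  where "open_ell2 U \<longleftrightarrow> (\<forall>x\<in>U. eventually (\<lambda>(x', y). x' = x \<longrightarrow> y \<in> U) uniformity)"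

instance
proof
  fix x y z :: "'a ell2" and r :: real and U :: "'a ell2 set"
  show "dist x y = norm (x - y)" by (rule dist_ell2_def)
  show "sgn x = x /\<^sub>R norm x" by (rule sgn_ell2_def)
  show "uniformity = (INF e\<in>{0 <..}. principal {(x :: 'a ell2, y). dist x y < e})"
    by (rule uniformity_ell2_def)
  show "open U \<longleftrightarrow> (\<forall>x\<in>U. eventually (\<lambda>(x', y). x' = x \<longrightarrow> y \<in> U) uniformity)"
    by (rule open_ell2_def)
  show "norm x = sqrt (inner x x)" by (rule norm_ell2_def)
  show "inner x y = inner y x" by (simp add: inner_ell2_def mult.commute)
  show "inner (x + y) z = inner x z + inner y z"
    by (simp add: inner_ell2_def distrib_right infsum_add ell2_summable_mult)
  show "inner (r *\<^sub>R x) y = r * inner x y"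
    by (simp add: inner_ell2_def mult.assoc infsum_cmult_right')
  show "0 \<le> inner x x" by (simp add: inner_ell2_def infsum_nonneg)
  show "inner x x = 0 \<longleftrightarrow> x = 0"
  proof
    assume "inner x x = 0"
    hence z: "(\<Sum>\<^sub>\<infinity>i. x $$ i * x $$ i) \<le> 0"
      unfolding inner_ell2_def by linarith
    have "x $$ i * x $$ i = 0" for i
      by (rule nonneg_infsum_le_0D[OF z ell2_summable_mult]) auto
    hence "x $$ i = 0 $$ i" for i by (simp only: mult_eq_0_iff disj_absorb ell2_nth_zero)
    thus "x = 0" by (rule ell2_eqI)
  next
    assume "x = 0"
    thus "inner x x = 0" by (simp only: inner_ell2_def ell2_nth_zero mult_zero_left infsum_0_simp)
  qed
qed

end


section \<open>Thresholding parameters\<close>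

definition F :: "real \<Rightarrow> real \<Rightarrow> real"
  where "F p t = t + p / 2 * sgn t * \<bar>t\<bar> powr (p - 1)"

definition F_inv :: "real \<Rightarrow> real \<Rightarrow> real"
  where "F_inv p = inv (F p)"

definition lambda' :: "real \<Rightarrow> real \<Rightarrow> real"
  where "lambda' r p =
    (if p = 1 then r + 1 / 4
     else (THE l. 0 < l \<and> (F_inv p l - l)\<^sup>2 + \<bar>F_inv p l\<bar> powr p = r powr p))"

definition delta :: "real \<Rightarrow> real \<Rightarrow> real"
  where "delta r p = lambda' r p - F_inv p (lambda' r p)"

lemma F_pos: "0 < t \<Longrightarrow> F p t = t + p / 2 * t powr (p - 1)"
  by (simp add: F_def)

lemma F_0 [simp]: "F p 0 = 0"
  by (simp add: F_def)

lemma F_minus: "F p (- t) = - F p t"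
  by (simp add: F_def sgn_minus)

lemma F_strict_mono:
  assumes "1 < p" shows "strict_mono (F p)"
proof (rule strict_monoI)
  have pos: "F p s < F p t" if "0 \<le> s" "s < t" for s t
  proof -
    have "s powr (p - 1) \<le> t powr (p - 1)" using that assms by (intro powr_mono2) auto
    hence "p / 2 * s powr (p - 1) \<le> p / 2 * t powr (p - 1)"
      using assms by (intro mult_left_mono) auto
    moreover have "F p s = s + p / 2 * s powr (p - 1)"
      using that by (cases "s = 0") (auto simp: F_pos)
    ultimately show ?thesis using that by (simp add: F_pos)
  qed
  fix s t :: real assume st: "s < t"
  consider "0 \<le> s" | "t \<le> 0" | "s < 0" "0 < t" by linarith
  thus "F p s < F p t"
  proof cases
    case 1 thus ?thesis using st pos by blast
  next
    case 2
    hence "F p (- t) < F p (- s)" using st by (intro pos) auto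
    thus ?thesis by (simp add: F_minus)
  next
    case 3
    have "F p 0 < F p t" "F p 0 < F p (- s)" using 3 pos[of 0 t] pos[of 0 "- s"] by auto
    thus ?thesis by (simp add: F_minus)
  qed
qed

lemma F_bij:
  assumes "1 < p" shows "bij (F p)"
proof -
  have ex: "\<exists>t. 0 \<le> t \<and> F p t = y" if "0 \<le> y" for y
  proof -
    have c: "continuous_on {0..y} (\<lambda>t. t + p / 2 * t powr (p - 1))"
      using assms by (intro continuous_intros continuous_on_powr') auto
    have "\<exists>t\<ge>0. t \<le> y \<and> t + p / 2 * t powr (p - 1) = y"
      using that assms c by (intro IVT') auto
    then obtain t where "0 \<le> t" "t + p / 2 * t powr (p - 1) = y" by blast
    moreover have "F p t = t + p / 2 * t powr (p - 1)"
      using \<open>0 \<le> t\<close> by (cases "t = 0") (auto simp: F_pos)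
    ultimately show ?thesis by auto
  qed
  have "\<exists>t. y = F p t" for y
  proof (cases "0 \<le> y")
    case True thus ?thesis using ex by metis
  next
    case False
    then obtain t where "F p t = - y" using ex[of "- y"] by auto
    hence "y = F p (- t)" by (simp add: F_minus)
    thus ?thesis ..
  qed
  hence "surj (F p)" by (simp add: surj_def)
  with strict_mono_imp_inj_on[OF F_strict_mono[OF assms]] show ?thesis by (rule bijI)
qed

lemma F_inv_F: "1 < p \<Longrightarrow> F_inv p (F p t) = t"
  unfolding F_inv_def by (rule inv_f_f[OF bij_is_inj[OF F_bij]])

lemma F_F_inv: "1 < p \<Longrightarrow> F p (F_inv p l) = l"
  unfolding F_inv_def by (rule surj_f_inv_f[OF bij_is_surj[OF F_bij]])

lemma lambda'_ex1:
  assumes p: "1 < p" and r: "0 < r"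
  shows "\<exists>!l. 0 < l \<and> (F_inv p l - l)\<^sup>2 + \<bar>F_inv p l\<bar> powr p = r powr p"
    (is "\<exists>!l. ?P l")
    and "0 < l \<Longrightarrow> (F_inv p l - l)\<^sup>2 + \<bar>F_inv p l\<bar> powr p = r powr p \<Longrightarrow>
      r < l \<and> l < r + p / 2 * r powr (p - 1) \<and> 0 < F_inv p l \<and> F_inv p l < r \<and> F_inv p l < l"
proof -
  define G where "G s = (p / 2 * s powr (p - 1))\<^sup>2 + s powr p" for s :: real
  have Gmono: "G s < G t" if "0 \<le> s" "s < t" for s t
  proof -
    have "s powr (p - 1) \<le> t powr (p - 1)" using that p by (intro powr_mono2) auto
    hence "p / 2 * s powr (p - 1) \<le> p / 2 * t powr (p - 1)"
      using p by (intro mult_left_mono) auto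
    hence "(p / 2 * s powr (p - 1))\<^sup>2 \<le> (p / 2 * t powr (p - 1))\<^sup>2"
      using p by (intro power_mono) auto
    moreover have "s powr p < t powr p" using that p by (intro powr_less_mono2) auto
    ultimately show ?thesis by (simp add: G_def)
  qed
  have par: "?P l \<longleftrightarrow> (\<exists>s>0. l = F p s \<and> G s = r powr p)" for l
  proof
    assume l: "?P l"
    define s where "s = F_inv p l"
    have Fs: "F p s = l" using p by (simp add: s_def F_F_inv)
    have s0: "0 < s"
      using l Fs strict_mono_less[OF F_strict_mono[OF p], of 0 s] by simp
    have "F_inv p l - l = - (p / 2 * s powr (p - 1))"
      using Fs s0 by (simp add: s_def[symmetric] F_pos)
    hence "G s = r powr p" using l s0 by (simp add: G_def s_def[symmetric])
    thus "\<exists>s>0. l = F p s \<and> G s = r powr p" using s0 Fs by blast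
  next
    assume "\<exists>s>0. l = F p s \<and> G s = r powr p"
    then obtain s where s: "0 < s" "l = F p s" "G s = r powr p" by blast
    have "0 < l" using s strict_mono_less[OF F_strict_mono[OF p], of 0 s] by simp
    moreover have i: "F_inv p l = s" using s p by (simp add: F_inv_F)
    moreover have "s - l = - (p / 2 * s powr (p - 1))" using s by (simp add: F_pos)
    ultimately show "?P l" using s by (simp add: G_def)
  qed
  have "\<exists>s\<ge>0. s \<le> r \<and> G s = r powr p"
  proof (rule IVT')
    show "continuous_on {0..r} G"
      unfolding G_def using p by (intro continuous_intros continuous_on_powr') auto
  qed (use p r in \<open>auto simp: G_def\<close>)
  then obtain s0 where s0: "0 \<le> s0" "G s0 = r powr p" by blast
  have "s0 \<noteq> 0" using s0 p r by (auto simp: G_def)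
  hence s0': "0 < s0" using s0 by simp
  show "\<exists>!l. ?P l"
  proof (rule ex1I[of _ "F p s0"])
    show "?P (F p s0)" using par s0 s0' by blast
  next
    fix l assume "?P l"
    then obtain s where s: "0 < s" "l = F p s" "G s = r powr p" using par by blast
    have "s = s0" using Gmono[of s s0] Gmono[of s0 s] s s0 s0' by (cases s s0 rule: linorder_cases) auto
    thus "l = F p s0" using s by simp
  qed
  assume "0 < l" "(F_inv p l - l)\<^sup>2 + \<bar>F_inv p l\<bar> powr p = r powr p"
  then obtain s where s: "0 < s" "l = F p s" "G s = r powr p" using par by blast
  have i: "F_inv p l = s" using s p by (simp add: F_inv_F)
  have sp: "0 < p / 2 * s powr (p - 1)" using s p by simp
  have "s powr p < r powr p"
  proof -
    have "0 < (p / 2 * s powr (p - 1))\<^sup>2" using sp by (rule zero_less_power)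
    thus ?thesis using s(3) unfolding G_def by linarith
  qed
  hence sr: "s < r" using s r p powr_mono2[of p r s] by (cases "s < r") auto
  have lr: "l < r + p / 2 * r powr (p - 1)"
    using strict_monoD[OF F_strict_mono[OF p] sr] s r by (simp add: F_pos)
  have "r < l"
  proof (rule ccontr)
    assume "\<not> r < l"
    define x where "x = p / 2 * s powr (p - 2)"
    have x0: "0 < x" using s p by (simp add: x_def)
    have sx: "p / 2 * s powr (p - 1) = s * x"
      using s powr_mult_base[of s "p - 2"] by (simp add: x_def)
    have l: "l = s * (1 + x)" using s sx by (simp add: F_pos algebra_simps)
    have "l powr p \<le> r powr p" using \<open>\<not> r < l\<close> \<open>0 < l\<close> p by (intro powr_mono2) auto
    hence "l powr p \<le> (s * x)\<^sup>2 + s powr p" using s(3) sx by (simp add: G_def)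
    moreover have "l powr p = s powr p * (1 + x) powr p" using l s x0 by (simp add: powr_mult)
    moreover have "1 + p * x \<le> (1 + x) powr p"
    proof -
      have px: "0 < p * x" using x0 p by simp
      have "(1 + p * x) powr (1 / p) * 1 powr (1 - 1 / p) \<le> 1 / p * (1 + p * x) + (1 - 1 / p) * 1"
        using p px by (intro Youngs_inequality_0) auto
      moreover have "1 / p * (1 + p * x) + (1 - 1 / p) * 1 = 1 + x" using p by (simp add: field_simps)
      ultimately have "(1 + p * x) powr (1 / p) \<le> 1 + x" by simp
      hence "((1 + p * x) powr (1 / p)) powr p \<le> (1 + x) powr p"
        using p by (intro powr_mono2) auto
      thus ?thesis using p px by (simp add: powr_powr)
    qed
    hence "s powr p * (1 + p * x) \<le> s powr p * (1 + x) powr p"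
      by (intro mult_left_mono) auto
    moreover have "(s * x)\<^sup>2 = s powr p * (p / 2 * x)"
    proof -
      have "s powr p = s\<^sup>2 * s powr (p - 2)"
        using s powr_add[of s 2 "p - 2"] by (simp add: powr_numeral)
      thus ?thesis by (simp add: power2_eq_square x_def)
    qed
    ultimately have "s powr p * (1 + p * x) \<le> s powr p * (1 + p / 2 * x)"
      by (simp add: algebra_simps)
    hence "p * x \<le> p / 2 * x" using s by simp
    thus False using x0 p by (simp add: field_simps)
  qed
  thus "r < l \<and> l < r + p / 2 * r powr (p - 1) \<and> 0 < F_inv p l \<and> F_inv p l < r \<and> F_inv p l < l"
    using lr i s sr sp by (simp add: F_pos)
qed

lemma lambda'_properties:
  assumes p: "1 < p" and r: "0 < r"
  defines "l \<equiv> lambda' r p"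
  shows "(F_inv p l - l)\<^sup>2 + \<bar>F_inv p l\<bar> powr p = r powr p"
    and "r < l" and "l < r + p / 2 * r powr (p - 1)"
    and "0 < F_inv p l" and "F_inv p l < r" and "0 < delta r p"
proof -
  have "l = (THE l. 0 < l \<and> (F_inv p l - l)\<^sup>2 + \<bar>F_inv p l\<bar> powr p = r powr p)"
    using p by (simp add: l_def lambda'_def)
  with theI'[OF lambda'_ex1(1)[OF p r]]
  have l: "0 < l" "(F_inv p l - l)\<^sup>2 + \<bar>F_inv p l\<bar> powr p = r powr p" by auto
  show "(F_inv p l - l)\<^sup>2 + \<bar>F_inv p l\<bar> powr p = r powr p" by (rule l(2))
  show "r < l" "l < r + p / 2 * r powr (p - 1)" "0 < F_inv p l" "F_inv p l < r" "0 < delta r p"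
    using lambda'_ex1(2)[OF p r l] by (auto simp: delta_def l_def)
qed


section \<open>The functional, its local minimizers, and the fixed point relation\<close>

text \<open>
  The functional takes values in the extended non-negative reals: for \<open>p < 2\<close> the sum may
  diverge on square-summable families.
\<close>
definition J :: "('i ell2 \<Rightarrow>\<^sub>L 'k ell2) \<Rightarrow> 'k ell2 \<Rightarrow> real \<Rightarrow> real \<Rightarrow> 'i ell2 \<Rightarrow> ennreal"
  where "J T g p r u =
    ennreal ((norm (blinfun_apply T u - g))\<^sup>2) +
    (\<Sum>\<^sub>\<infinity>i. ennreal (min (\<bar>u $$ i\<bar> powr p) (r powr p)))"

definition local_minimizer :: "('a::metric_space \<Rightarrow> 'b::order) \<Rightarrow> 'a \<Rightarrow> bool"
  where "local_minimizer f u \<longleftrightarrow> (\<exists>\<epsilon>>0. \<forall>v. dist v u < \<epsilon> \<longrightarrow> f u \<le> f v)"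

text \<open>
  For \<open>p = 1\<close> the clauses describe the fixed points \<open>u\<^sub>i = H (u\<^sub>i + w\<^sub>i)\<close>,
  \<open>w = T\<^sup>* (g - T u)\<close>, of the thresholding map \<open>H t = 0\<close> for \<open>\<bar>t\<bar> \<le> 1/2\<close>,
  \<open>H t = t - sgn t / 2\<close> for \<open>1/2 < \<bar>t\<bar> \<le> r + 1/4\<close> and \<open>H t = t\<close> for \<open>\<bar>t\<bar> > r + 1/4\<close>
  (either of the last two values being admitted at \<open>\<bar>t\<bar> = r + 1/4\<close>).  The interval
  \<open>[-1/2, 1/2]\<close> is attached to \<open>u\<^sub>i = 0\<close>, i.e. to \<open>\<bar>u\<^sub>i + w\<^sub>i\<bar> \<le> 1/2\<close>;
  attaching it to all \<open>\<bar>u\<^sub>i\<bar> \<le> 1/2\<close> instead would admit points at which the functional is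
  differentiable with non-zero gradient.  The bound \<open>r - 1/4\<close>, the left limit of \<open>\<bar>H\<bar>\<close>
  at its jump, takes the place that \<open>F_inv p (lambda' r p)\<close> has for \<open>p > 1\<close>.
\<close>
definition fixed_point_relation ::
    "('i ell2 \<Rightarrow>\<^sub>L 'k ell2) \<Rightarrow> 'k ell2 \<Rightarrow> real \<Rightarrow> real \<Rightarrow> 'i ell2 \<Rightarrow> bool"
  where "fixed_point_relation T g p r u \<longleftrightarrow>
    (let w = adjoint (blinfun_apply T) (g - blinfun_apply T u) in
      (\<forall>i. \<bar>u $$ i\<bar> > r \<longrightarrow> \<bar>u $$ i\<bar> \<ge> lambda' r p) \<and>
      (p > 1 \<longrightarrow> (\<forall>i.
        (\<bar>u $$ i\<bar> \<le> r \<longrightarrow> \<bar>u $$ i\<bar> \<le> F_inv p (lambda' r p)) \<and>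
        (\<bar>u $$ i\<bar> \<ge> lambda' r p \<longrightarrow> w $$ i = 0) \<and>
        (\<bar>u $$ i\<bar> \<le> lambda' r p - delta r p \<longrightarrow> w $$ i = F p (u $$ i) - u $$ i))) \<and>
      (p = 1 \<longrightarrow> (\<forall>i.
        (\<bar>u $$ i\<bar> \<le> r \<longrightarrow> \<bar>u $$ i\<bar> \<le> r - 1 / 4) \<and>
        (u $$ i = 0 \<longrightarrow> w $$ i \<in> {- 1 / 2 .. 1 / 2}) \<and>
        (0 < \<bar>u $$ i\<bar> \<and> \<bar>u $$ i\<bar> \<le> r - 1 / 4 \<longrightarrow> w $$ i = sgn (u $$ i) / 2) \<and>
        (\<bar>u $$ i\<bar> \<ge> r + 1 / 4 \<longrightarrow> w $$ i = 0))))"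

end

theory Submission
  imports Defs
begin

text \<open>
  With \<open>w = T\<^sup>* (g - T u)\<close> and \<open>h = v - u\<close>, expanding the square gives
  \<open>\<parallel>T v - g\<parallel>\<^sup>2 = \<parallel>T u - g\<parallel>\<^sup>2 - 2 \<langle>h, w\<rangle> + \<parallel>T h\<parallel>\<^sup>2\<close>, so it is enough to have
  \<open>min \<bar>u\<^sub>i\<bar>\<^sup>p r\<^sup>p + 2 h\<^sub>i w\<^sub>i \<le> min \<bar>v\<^sub>i\<bar>\<^sup>p r\<^sup>p\<close> in every coordinate.  The fixed point relation
  keeps all \<open>\<bar>u\<^sub>i\<bar>\<close> at a uniform distance from \<open>r\<close>.  For \<open>h\<close> small, the coordinates with
  \<open>\<bar>u\<^sub>i\<bar> > r\<close> therefore stay where the penalty is constant and \<open>w\<^sub>i = 0\<close>, while for the others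
  \<open>\<bar>v\<^sub>i\<bar> \<le> r\<close> and \<open>2 w\<^sub>i\<close> is a subgradient of the convex function \<open>\<bar>\<sqdot>\<bar>\<^sup>p\<close> at \<open>u\<^sub>i\<close>.
\<close>

lemma ell2_nth_sum: "sum f A $$ i = (\<Sum>j\<in>A. f j $$ i)"
  by (induction A rule: infinite_finite_induct) auto

lemma power2_norm_ell2: "(norm x)\<^sup>2 = (\<Sum>\<^sub>\<infinity>i. (x $$ i)\<^sup>2)" for x :: "'i ell2"
  by (simp only: power2_norm_eq_inner inner_ell2_def) (simp only: power2_eq_square)

lemma abs_ell2_nth_le_norm: "\<bar>x $$ i\<bar> \<le> norm x"
proof -
  have "(\<Sum>j\<in>{i}. (x $$ j)\<^sup>2) \<le> (\<Sum>\<^sub>\<infinity>j. (x $$ j)\<^sup>2)"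
    by (rule finite_sum_le_infsum[OF ell2_summable_sq]) auto
  hence "\<bar>x $$ i\<bar>\<^sup>2 \<le> (norm x)\<^sup>2"
    by (simp add: power2_norm_ell2)
  thus ?thesis
    by (rule power2_le_imp_le) simp
qed

lift_definition ell2_unit :: "'i \<Rightarrow> 'i ell2" is "\<lambda>i j. if j = i then 1 else 0"
proof -
  fix i :: 'i
  have "(\<lambda>j. (if j = i then 1 else 0 :: real)\<^sup>2) summable_on {i}"
    by simp
  thus "(\<lambda>j. (if j = i then 1 else 0 :: real)\<^sup>2) summable_on UNIV"
    by (rule summable_on_cong_neutral[THEN iffD1, rotated -1]) auto
qed

lemma ell2_nth_sum_unit:
  assumes "finite A"
  shows "(\<Sum>i\<in>A. c i *\<^sub>R ell2_unit i) $$ j = (if j \<in> A then c j else 0)"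
proof -
  have "(\<Sum>i\<in>A. c i *\<^sub>R ell2_unit i) $$ j = (\<Sum>i\<in>A. if j = i then c i else 0)"
    unfolding ell2_nth_sum by (intro sum.cong) (auto simp: ell2_unit.rep_eq)
  thus ?thesis
    using assms by simp
qed

lemma has_sum_ell2_unit: "((\<lambda>i. x $$ i *\<^sub>R ell2_unit i) has_sum x) UNIV"
proof -
  define s where "s = (\<lambda>A. \<Sum>i\<in>A. (x $$ i)\<^sup>2)"
  have dist: "dist (\<Sum>i\<in>A. x $$ i *\<^sub>R ell2_unit i) x = sqrt ((norm x)\<^sup>2 - s A)" if A: "finite A" for A
  proof -
    have "(norm (x - (\<Sum>i\<in>A. x $$ i *\<^sub>R ell2_unit i)))\<^sup>2 = (\<Sum>\<^sub>\<infinity>i\<in>UNIV - A. (x $$ i)\<^sup>2)"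
      unfolding power2_norm_ell2
      by (rule infsum_cong_neutral) (auto simp: ell2_nth_sum_unit[OF A])
    also have "\<dots> = (norm x)\<^sup>2 - s A"
      using infsum_Diff[OF ell2_summable_sq[of x], of A] A by (simp add: power2_norm_ell2 s_def)
    finally show ?thesis
      by (simp add: dist_norm norm_minus_commute real_sqrt_unique)
  qed
  have "(s \<longlongrightarrow> (norm x)\<^sup>2) (finite_subsets_at_top UNIV)"
    unfolding power2_norm_ell2 s_def by (rule infsum_tendsto[OF ell2_summable_sq])
  hence "((\<lambda>A. sqrt ((norm x)\<^sup>2 - s A)) \<longlongrightarrow> sqrt ((norm x)\<^sup>2 - (norm x)\<^sup>2)) (finite_subsets_at_top UNIV)"
    by (intro tendsto_intros)
  hence "((\<lambda>A. sqrt ((norm x)\<^sup>2 - s A)) \<longlongrightarrow> 0) (finite_subsets_at_top UNIV)"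
    by simp
  moreover have "\<forall>\<^sub>F A in finite_subsets_at_top UNIV.
      sqrt ((norm x)\<^sup>2 - s A) = dist (\<Sum>i\<in>A. x $$ i *\<^sub>R ell2_unit i) x"
    by (rule eventually_finite_subsets_at_top_weakI) (simp add: dist)
  ultimately show ?thesis
    unfolding has_sum_def tendsto_dist_iff[of _ x] by (rule Lim_transform_eventually)
qed

lemma ell2_riesz:
  fixes f :: "'i ell2 \<Rightarrow> real"
  assumes "bounded_linear f"
  shows "\<exists>w. \<forall>x. f x = x \<bullet> w"
proof -
  interpret f: bounded_linear f by fact
  define c where "c i = f (ell2_unit i)" for i
  obtain K where K: "\<And>x. norm (f x) \<le> norm x * K" "K > 0"
    using f.pos_bounded by blast
  have "sum (\<lambda>i. (c i)\<^sup>2) A \<le> K\<^sup>2" if A: "finite A" for A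
  proof -
    define x where "x = (\<Sum>i\<in>A. c i *\<^sub>R ell2_unit i)"
    define s where "s = (\<Sum>i\<in>A. (c i)\<^sup>2)"
    have fx: "f x = s"
      by (simp add: x_def s_def f.sum f.scaleR c_def power2_eq_square)
    have "(norm x)\<^sup>2 = (\<Sum>\<^sub>\<infinity>i\<in>A. (c i)\<^sup>2)"
      unfolding power2_norm_ell2 x_def
      by (rule infsum_cong_neutral) (auto simp: ell2_nth_sum_unit[OF A])
    hence nx: "(norm x)\<^sup>2 = s"
      using A by (simp add: s_def)
    have "norm x * norm x \<le> norm x * K"
      using K(1)[of x] fx nx by (simp add: power2_eq_square)
    hence "norm x \<le> K"
      using K(2) by (cases "norm x = 0") auto
    hence "(norm x)\<^sup>2 \<le> K\<^sup>2"
      by (intro power_mono) auto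
    thus ?thesis
      using nx by (simp add: s_def)
  qed
  hence sq: "(\<lambda>i. (c i)\<^sup>2) summable_on UNIV"
    by (intro nonneg_bdd_above_summable_on bdd_aboveI2[where M = "K\<^sup>2"]) auto
  have "f x = x \<bullet> Abs_ell2 c" for x
  proof -
    have "((\<lambda>i. f (x $$ i *\<^sub>R ell2_unit i)) has_sum f x) UNIV"
      using has_sum_bounded_linear[OF assms has_sum_ell2_unit] by (simp add: o_def)
    hence "f x = (\<Sum>\<^sub>\<infinity>i. x $$ i * c i)"
      by (simp add: f.scaleR c_def infsumI)
    thus ?thesis
      using sq by (simp add: inner_ell2_def Abs_ell2_inverse)
  qed
  thus ?thesis by blast
qed

lemma inner_adjoint_ell2:
  fixes T :: "'i ell2 \<Rightarrow>\<^sub>L 'k ell2"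
  shows "blinfun_apply T x \<bullet> y = x \<bullet> adjoint (blinfun_apply T) y"
proof -
  have "\<exists>w. \<forall>x. blinfun_apply T x \<bullet> y = x \<bullet> w" for y
    by (rule ell2_riesz, rule bounded_linear_inner_left_comp, rule blinfun.bounded_linear_right)
  hence "\<exists>f. \<forall>x y. blinfun_apply T x \<bullet> y = x \<bullet> f y"
    by metis
  hence "\<forall>x y. blinfun_apply T x \<bullet> y = x \<bullet> adjoint (blinfun_apply T) y"
    unfolding adjoint_def by (rule someI_ex)
  thus ?thesis by blast
qed

lemma power2_norm_residual_ge:
  fixes T :: "'i ell2 \<Rightarrow>\<^sub>L 'k ell2" and g :: "'k ell2" and u v :: "'i ell2"
  defines "w \<equiv> adjoint (blinfun_apply T) (g - blinfun_apply T u)"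
  shows "(norm (blinfun_apply T u - g))\<^sup>2 - 2 * ((v - u) \<bullet> w) \<le> (norm (blinfun_apply T v - g))\<^sup>2"
proof -
  define k where "k = blinfun_apply T (v - u)"
  have "blinfun_apply T v - g = k - (g - blinfun_apply T u)"
    by (simp add: k_def blinfun.diff_right)
  hence "(norm (blinfun_apply T v - g))\<^sup>2 =
      (norm k)\<^sup>2 - 2 * (k \<bullet> (g - blinfun_apply T u)) + (norm (blinfun_apply T u - g))\<^sup>2"
    by (simp only: power2_norm_eq_inner inner_diff) (simp add: inner_commute)
  thus ?thesis
    unfolding w_def inner_adjoint_ell2[symmetric] k_def[symmetric] by simp
qed

lemma abs_powr_ge_tangent:
  fixes p x y :: real
  assumes p: "1 < p"
  shows "\<bar>x\<bar> powr p + p * sgn x * \<bar>x\<bar> powr (p - 1) * (y - x) \<le> \<bar>y\<bar> powr p"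
proof -
  have "\<bar>x\<bar> powr (p - 1) * \<bar>y\<bar> \<le>
      (\<bar>x\<bar> powr (p - 1)) powr (p / (p - 1)) / (p / (p - 1)) + \<bar>y\<bar> powr p / p"
    using p by (intro Youngs_inequality) (auto simp: field_simps)
  moreover have "(\<bar>x\<bar> powr (p - 1)) powr (p / (p - 1)) = \<bar>x\<bar> powr p"
    using p by (simp add: powr_powr)
  ultimately have young: "p * (\<bar>x\<bar> powr (p - 1) * \<bar>y\<bar>) \<le> (p - 1) * \<bar>x\<bar> powr p + \<bar>y\<bar> powr p"
    using p by (simp add: field_simps)
  have "sgn x * y \<le> \<bar>y\<bar>"
    by (auto simp: sgn_if)
  hence "p * (\<bar>x\<bar> powr (p - 1)) * (sgn x * y) \<le> p * (\<bar>x\<bar> powr (p - 1)) * \<bar>y\<bar>"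
    using p by (intro mult_left_mono) auto
  moreover have "\<bar>x\<bar> powr (p - 1) * (sgn x * x) = \<bar>x\<bar> powr p"
    using powr_mult_base[of "\<bar>x\<bar>" "p - 1"] by (simp add: abs_sgn[symmetric] mult.commute)
  ultimately show ?thesis
    using young by (simp add: algebra_simps)
qed

lemma min_powr_ge_tangent:
  fixes p x y r :: real
  assumes "1 < p" "\<bar>y\<bar> \<le> r"
  shows "min (\<bar>x\<bar> powr p) (r powr p) + p * sgn x * \<bar>x\<bar> powr (p - 1) * (y - x)
    \<le> min (\<bar>y\<bar> powr p) (r powr p)"
proof -
  have "\<bar>y\<bar> powr p \<le> r powr p"
    using assms by (intro powr_mono2) auto
  thus ?thesis
    using abs_powr_ge_tangent[OF assms(1), of x y] by linarith
qed

lemma summable_on_if_infsum_ennreal_finite: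
  assumes nn: "\<And>i. i \<in> A \<Longrightarrow> 0 \<le> f i" and fin: "(\<Sum>\<^sub>\<infinity>i\<in>A. ennreal (f i)) \<noteq> \<infinity>"
  shows "f summable_on A"
proof (intro nonneg_bdd_above_summable_on bdd_aboveI2 nn)
  fix F assume "F \<in> {F. F \<subseteq> A \<and> finite F}"
  hence F: "F \<subseteq> A" "finite F" by auto
  have "ennreal (sum f F) = (\<Sum>\<^sub>\<infinity>i\<in>F. ennreal (f i))"
    using F nn by (simp add: sum_ennreal subset_iff)
  also have "\<dots> \<le> (\<Sum>\<^sub>\<infinity>i\<in>A. ennreal (f i))"
    using F by (intro infsum_mono_neutral nonneg_summable_on_complete) auto
  finally have "ennreal (sum f F) \<le> (\<Sum>\<^sub>\<infinity>i\<in>A. ennreal (f i))" .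
  moreover have "0 \<le> sum f F"
    using F nn by (intro sum_nonneg) auto
  ultimately show "sum f F \<le> enn2real (\<Sum>\<^sub>\<infinity>i\<in>A. ennreal (f i))"
    using fin by (metis enn2real_ennreal enn2real_mono infinity_ennreal_def top.not_eq_extremum)
qed

lemma infsum_ennreal:
  assumes "f summable_on A" "\<And>i. i \<in> A \<Longrightarrow> 0 \<le> f i"
  shows "(\<Sum>\<^sub>\<infinity>i\<in>A. ennreal (f i)) = ennreal (infsum f A)"
  using infsum_nonneg_is_SUPREMUM_ennreal[OF assms]
  by (subst nonneg_infsum_complete) (auto intro!: SUP_cong simp: sum_ennreal assms subset_iff)

lemma J_le_J_if_coordinatewise:
  fixes T :: "'i ell2 \<Rightarrow>\<^sub>L 'k ell2" and g :: "'k ell2" and u v :: "'i ell2"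
  defines "w \<equiv> adjoint (blinfun_apply T) (g - blinfun_apply T u)"
  assumes coord: "\<And>i. min (\<bar>u $$ i\<bar> powr p) (r powr p) + 2 * w $$ i * (v $$ i - u $$ i)
    \<le> min (\<bar>v $$ i\<bar> powr p) (r powr p)"
  shows "J T g p r u \<le> J T g p r v"
proof -
  define a where "a = (\<lambda>i. min (\<bar>u $$ i\<bar> powr p) (r powr p))"
  define b where "b = (\<lambda>i. min (\<bar>v $$ i\<bar> powr p) (r powr p))"
  define c where "c = (\<lambda>i. - 2 * ((v - u) $$ i * w $$ i))"
  have nn: "0 \<le> a i" "0 \<le> b i" for i
    by (auto simp: a_def b_def)
  have Ju: "J T g p r u = ennreal ((norm (blinfun_apply T u - g))\<^sup>2) + (\<Sum>\<^sub>\<infinity>i. ennreal (a i))"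
    and Jv: "J T g p r v = ennreal ((norm (blinfun_apply T v - g))\<^sup>2) + (\<Sum>\<^sub>\<infinity>i. ennreal (b i))"
    by (simp_all add: J_def a_def b_def)
  show ?thesis
  proof (cases "(\<Sum>\<^sub>\<infinity>i. ennreal (b i)) = \<infinity>")
    case True
    thus ?thesis by (simp add: Jv)
  next
    case False
    have b: "b summable_on UNIV"
      using nn(2) False by (rule summable_on_if_infsum_ennreal_finite)
    have c: "c summable_on UNIV"
      unfolding c_def by (intro summable_on_cmult_right ell2_summable_mult)
    have bc: "(\<lambda>i. b i + c i) summable_on UNIV"
      using b c by (rule summable_on_add)
    have "a i + 2 * w $$ i * (v $$ i - u $$ i) \<le> b i" for i
      using coord[of i] by (simp only: a_def b_def)
    hence abc: "a i \<le> b i + c i" for i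
      by (simp add: c_def algebra_simps)
    have a: "a summable_on UNIV"
      using bc abc nn(1) by (rule summable_on_comparison_test)
    have "infsum a UNIV \<le> (\<Sum>\<^sub>\<infinity>i. b i + c i)"
      using a bc abc by (rule infsum_mono)
    also have "\<dots> = infsum b UNIV + infsum c UNIV"
      using b c by (rule infsum_add)
    also have "infsum c UNIV = - 2 * ((v - u) \<bullet> w)"
      unfolding c_def inner_ell2_def by (rule infsum_cmult_right')
    finally have "(norm (blinfun_apply T u - g))\<^sup>2 + infsum a UNIV
        \<le> (norm (blinfun_apply T v - g))\<^sup>2 + infsum b UNIV"
      using power2_norm_residual_ge[of T u g v] by (simp add: w_def)
    thus ?thesis
      unfolding Ju Jv infsum_ennreal[OF a nn(1)] infsum_ennreal[OF b nn(2)]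
      using nn by (simp flip: ennreal_plus add: infsum_nonneg ennreal_leI)
  qed
qed

lemma coordinatewise_p_gt_1:
  fixes T :: "'i ell2 \<Rightarrow>\<^sub>L 'k ell2" and g :: "'k ell2" and u v :: "'i ell2"
  assumes p: "1 < p" and r: "0 < r" and fp: "fixed_point_relation T g p r u"
  defines "w \<equiv> adjoint (blinfun_apply T) (g - blinfun_apply T u)"
  assumes h1: "\<bar>v $$ i - u $$ i\<bar> < lambda' r p - r"
    and h0: "\<bar>v $$ i - u $$ i\<bar> < r - F_inv p (lambda' r p)"
  shows "min (\<bar>u $$ i\<bar> powr p) (r powr p) + 2 * w $$ i * (v $$ i - u $$ i)
    \<le> min (\<bar>v $$ i\<bar> powr p) (r powr p)"
proof (cases "\<bar>u $$ i\<bar> > r")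
  case True
  hence "\<bar>u $$ i\<bar> \<ge> lambda' r p" and w: "w $$ i = 0"
    using fp p by (auto simp: fixed_point_relation_def w_def Let_def)
  hence "r \<le> \<bar>v $$ i\<bar>"
    using h1 by linarith
  hence "r powr p \<le> \<bar>v $$ i\<bar> powr p"
    using p r by (intro powr_mono2) auto
  thus ?thesis
    using w by simp
next
  case False
  hence le: "\<bar>u $$ i\<bar> \<le> F_inv p (lambda' r p)"
    using fp p by (auto simp: fixed_point_relation_def Let_def)
  hence "w $$ i = F p (u $$ i) - u $$ i"
    using fp p by (auto simp: fixed_point_relation_def w_def Let_def delta_def)
  hence "2 * w $$ i = p * sgn (u $$ i) * \<bar>u $$ i\<bar> powr (p - 1)"
    by (simp add: F_def)
  moreover have "\<bar>v $$ i\<bar> \<le> r"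
    using le h0 by linarith
  ultimately show ?thesis
    using min_powr_ge_tangent[OF p, of "v $$ i" r "u $$ i"] by simp
qed

lemma coordinatewise_p_eq_1:
  fixes T :: "'i ell2 \<Rightarrow>\<^sub>L 'k ell2" and g :: "'k ell2" and u v :: "'i ell2"
  assumes r: "1 / 4 \<le> r" and fp: "fixed_point_relation T g 1 r u"
  defines "w \<equiv> adjoint (blinfun_apply T) (g - blinfun_apply T u)"
  assumes h: "\<bar>v $$ i - u $$ i\<bar> < 1 / 4"
  shows "min \<bar>u $$ i\<bar> r + 2 * w $$ i * (v $$ i - u $$ i) \<le> min \<bar>v $$ i\<bar> r"
proof (cases "\<bar>u $$ i\<bar> > r")
  case True
  hence "\<bar>u $$ i\<bar> \<ge> r + 1 / 4" and "w $$ i = 0"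
    using fp by (auto simp: fixed_point_relation_def w_def Let_def lambda'_def)
  moreover from this have "\<bar>v $$ i\<bar> \<ge> r"
    using h by linarith
  ultimately show ?thesis
    by simp
next
  case False
  hence le: "\<bar>u $$ i\<bar> \<le> r - 1 / 4"
    using fp by (auto simp: fixed_point_relation_def Let_def)
  have "2 * w $$ i * (v $$ i - u $$ i) \<le> \<bar>v $$ i\<bar> - \<bar>u $$ i\<bar>"
  proof (cases "u $$ i = 0")
    case True
    hence "\<bar>2 * w $$ i\<bar> \<le> 1"
      using fp by (auto simp: fixed_point_relation_def w_def Let_def)
    hence "\<bar>2 * w $$ i\<bar> * \<bar>v $$ i\<bar> \<le> 1 * \<bar>v $$ i\<bar>"
      by (rule mult_right_mono) simp
    thus ?thesis
      using True by (simp add: abs_mult[symmetric])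
  next
    case nz: False
    hence "2 * w $$ i = sgn (u $$ i)"
      using fp le by (auto simp: fixed_point_relation_def w_def Let_def)
    thus ?thesis
      using nz by (auto simp: sgn_if)
  qed
  thus ?thesis
    using le h by linarith
qed

theorem theorem4p6p1:
  fixes T :: "'i::countable ell2 \<Rightarrow>\<^sub>L 'k::countable ell2"
    and g :: "'k ell2" and u :: "'i ell2" and p r :: real
  assumes "1 \<le> p"
    and "p \<le> 2 \<or> finite (UNIV :: 'i set)"
    and "0 < r"
    and "p = 1 \<Longrightarrow> r \<ge> 1 / 4"
    and "norm T < 1"
    and "fixed_point_relation T g p r u"
  shows "local_minimizer (J T g p r) u"
proof -
  define e where "e = (if p = 1 then 1 / 4 else min (lambda' r p - r) (r - F_inv p (lambda' r p)))"
  have "e > 0"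
    using assms lambda'_properties[of p r] by (auto simp: e_def)
  moreover have "J T g p r u \<le> J T g p r v" if "dist v u < e" for v
  proof (rule J_le_J_if_coordinatewise)
    fix i
    have h: "\<bar>v $$ i - u $$ i\<bar> < e"
      using abs_ell2_nth_le_norm[of "v - u" i] that by (simp add: dist_norm)
    show "min (\<bar>u $$ i\<bar> powr p) (r powr p) +
        2 * adjoint (blinfun_apply T) (g - blinfun_apply T u) $$ i * (v $$ i - u $$ i)
      \<le> min (\<bar>v $$ i\<bar> powr p) (r powr p)"
    proof (cases "p = 1")
      case True
      thus ?thesis
        using coordinatewise_p_eq_1[of r T g u v i] assms h by (simp add: e_def)
    next
      case False
      thus ?thesis
        using assms h by (intro coordinatewise_p_gt_1[of p r T g u v i]) (auto simp: e_def)
    qed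
  qed
  ultimately show ?thesis
    unfolding local_minimizer_def by blast
qed

end
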